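(* Let $L=M\left(\left.\frac{p_1}{q_1},\frac{p_2}{q_2},\dots,\frac{p_n}{q_n}\right| e\right)$ be a Montesinos link, with $p_i,q_i$ relatively prime integers for each $i$ and $e$ an integer, such that exactly two of its rational tangles, $T_i$ and $T_j$, are $H$-tangles. Then the linking number of $L$ (which has two components) is $$lk(L) = \pm\left( lk(R_{p_i/q_i})+(-1)^{\sigma}\,lk(R_{p_j/q_j})\right),\qquad \sigma=\sum_{k=1}^n q_k+e,$$ where $R_{p/q}$ denotes the oriented rational $\frac pq$-link, and the overall sign $\pm$ depends on the orientations of the components of $L$.
   Context: Linking number: for an oriented link diagram, a crossing between two different components is positive if the overstrand passes the understrand from left to right (as seen when travelling along the oriented understrand), and negative otherwise. The linking number of two components is half the sum of the signs of the crossings between them; for a two-component link $L$, $lk(L)$ is the linking number of its two components. Rational tangles: a 2-tangle is a proper embedding of two disjoint arcs in a 3-ball whose four endpoints lie on the boundary sphere and are labelled NW, NE, SW, SE. Let $T_0$ be the 2-tangle made of two horizontal arcs without crossings (joining NW to NE and SW to SE); its fraction is $0/1$. A rational tangle is a 2-tangle obtained from $T_0$ by horizontal and vertical twists. Let $[+1]$ be the one-crossing tangle whose overstrand has positive slope (runs from SW to NE), and $[-1]$ the one whose overstrand has negative slope. Adding a positive (resp. negative) horizontal twist means placing $[+1]$ (resp. $[-1]$) to the right of the tangle and joining adjacent endpoints; it changes the fraction $F$ to $F+1$ (resp. $F-1$). Adding a positive (resp. negative) vertical twist means placing $[+1]$ (resp. $[-1]$) below the tangle and joining adjacent endpoints;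 it changes the fraction $F$ so that $1/F$ becomes $1/F+1$ (resp. $1/F-1$), with $1/0=\infty$ and $1/\infty=0$. By Conway's theorem two rational tangles are equivalent (isotopic fixing the endpoints) if and only if their fractions are equal. A rational $\frac pq$-tangle ($p,q$ relatively prime) is a rational tangle with fraction $\frac pq$. Types: a rational tangle is a $V$-, $D$- or $H$-tangle if the strand starting at NW ends at SW, SE or NE, respectively. A $\frac pq$-tangle is a $V$-tangle iff $p$ is odd and $q$ is even, a $D$-tangle iff $p$ and $q$ are both odd, and an $H$-tangle iff $p$ is even and $q$ is odd. Rational links: the numerator closure $N(T)$ of a rational tangle $T$ is obtained by joining NW with NE and SW with SE by arcs outside the ball, without crossings. For $p$ even and $T$ a rational $\frac pq$-tangle, $N(T)$ has two components, and $R_{p/q}$ is the oriented link $N(T)$ in which the strand with endpoints NE, NW is oriented from NE to NW and the other strand is oriented from SW to SE; $lk(R_{p/q})$ is the linking number of its two components. Montesinos links: $M\left(\left.\frac{p_1}{q_1},\dots,\frac{p_n}{q_n}\right| e\right)$ is the link formed by stacking vertically, from top to bottom, rational $\frac{p_i}{q_i}$-tangles $T_1,\dots,T_n$ and then $e$ half twists, each one's SW and SE endpoints being joined to the NW and NE endpoints, respectively, of the next one, and finally joining the SW and SE endpoints of the bottom piece to the NW and NE endpoints of $T_1$, respectively, by two arcs without crossings running parallel outside, so that the pieces are connected in cyclic order. The $e$ half twists are $|e|$ crossings stacked vertically, each being $[+1]$ if $e>0$ and $[-1]$ if $e<0$ (two vertical parallel strands if $e=0$). *)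

theory Defs
  imports Complex_Main
begin

section \<open>Link and tangle diagrams\<close>

text \<open>
  A diagram is assembled from elementary pieces, each a square with four labelled corners.
  A piece is either a pair of crossingless arcs or a single crossing, placed so that its two
  strands are the diagonals NW--SE and SW--NE. A point \<open>(k, c)\<close> is corner \<open>c\<close> of the
  \<open>k\<close>-th piece; inside a piece the corners are paired by its strands, outside the pieces
  they are paired by the crossingless arcs in \<open>joins\<close>. Every link diagram in the plane can be
  drawn in this way, since each crossing can be rotated into the diagonal position.
\<close>

datatype corner = NW | NE | SW | SE

datatype piece =
    HArcs     \<comment> \<open>arcs NW--NE and SW--SE\<close>
  | VArcs     \<comment> \<open>arcs NW--SW and NE--SE\<close>
  | PosSlope  \<comment> \<open>the crossing whose overstrand is SW--NE\<close>
  | NegSlope  \<comment> \<open>the crossing whose overstrand is NW--SE\<close>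

type_synonym point = "nat \<times> corner"

record diagram =
  pieces :: "piece list"
  joins :: "(point \<times> point) set"

record tangle = diagram +
  ends :: "corner \<Rightarrow> point"

fun diagonal :: "corner \<Rightarrow> corner" where
  "diagonal NW = SE" | "diagonal SE = NW" | "diagonal NE = SW" | "diagonal SW = NE"

fun across :: "piece \<Rightarrow> corner \<Rightarrow> corner" where
  "across HArcs c = (case c of NW \<Rightarrow> NE | NE \<Rightarrow> NW | SW \<Rightarrow> SE | SE \<Rightarrow> SW)"
| "across VArcs c = (case c of NW \<Rightarrow> SW | SW \<Rightarrow> NW | NE \<Rightarrow> SE | SE \<Rightarrow> NE)"
| "across PosSlope c = diagonal c"
| "across NegSlope c = diagonal c"

definition points :: "'a diagram_scheme \<Rightarrow> point set" where
  "points D = {..<length (pieces D)} \<times> UNIV"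

definition strands :: "'a diagram_scheme \<Rightarrow> (point \<times> point) set" where
  "strands D = {((k, c), (k, across (pieces D ! k) c)) | k c. k < length (pieces D)}"

definition connected_points :: "'a diagram_scheme \<Rightarrow> (point \<times> point) set" where
  "connected_points D = (strands D \<union> joins D \<union> (joins D)\<inverse>)\<^sup>*"

definition components :: "'a diagram_scheme \<Rightarrow> point set set" where
  "components D = points D // connected_points D"


section \<open>Orientations and linking numbers\<close>

text \<open>
  An orientation records, for each point, whether the oriented curve leaves
  (\<open>True\<close>) or enters (\<open>False\<close>) the piece at that corner.
\<close>

definition orientation :: "'a diagram_scheme \<Rightarrow> (point \<Rightarrow> bool) \<Rightarrow> bool" where
  "orientation D ori \<longleftrightarrow> (\<forall>(x, y) \<in> strands D \<union> joins D. ori x \<noteq> ori y)"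

text \<open>Counterclockwise neighbour: for a strand leaving a crossing at corner \<open>c\<close>, the corner on
  its left-hand side is \<open>ccw c\<close>.\<close>

fun ccw :: "corner \<Rightarrow> corner" where
  "ccw NE = NW" | "ccw NW = SW" | "ccw SW = SE" | "ccw SE = NE"

fun under_exit :: "piece \<Rightarrow> (corner \<Rightarrow> bool) \<Rightarrow> corner" where
  "under_exit PosSlope out = (if out NW then NW else SE)"
| "under_exit NegSlope out = (if out NE then NE else SW)"
| "under_exit _ out = undefined"

definition crossings :: "'a diagram_scheme \<Rightarrow> nat set" where
  "crossings D = {k. k < length (pieces D) \<and> pieces D ! k \<in> {PosSlope, NegSlope}}"

text \<open>A crossing is positive if the overstrand enters it on the left of the oriented understrand
  (and hence leaves it on the right).\<close>

definition crossing_sign :: "'a diagram_scheme \<Rightarrow> (point \<Rightarrow> bool) \<Rightarrow> nat \<Rightarrow> rat" where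
  "crossing_sign D ori k =
    (if ori (k, ccw (under_exit (pieces D ! k) (\<lambda>c. ori (k, c)))) then - 1 else 1)"

text \<open>The strands of crossing \<open>k\<close> are represented by their upper ends \<open>(k, NW)\<close> and
  \<open>(k, NE)\<close>.\<close>

definition crossings_between :: "'a diagram_scheme \<Rightarrow> point set \<Rightarrow> point set \<Rightarrow> nat set" where
  "crossings_between D A B =
    {k \<in> crossings D. (k, NW) \<in> A \<and> (k, NE) \<in> B \<or> (k, NW) \<in> B \<and> (k, NE) \<in> A}"

definition linking_number ::
    "'a diagram_scheme \<Rightarrow> (point \<Rightarrow> bool) \<Rightarrow> point set \<Rightarrow> point set \<Rightarrow> rat" where
  "linking_number D ori A B = (\<Sum>k \<in> crossings_between D A B. crossing_sign D ori k) / 2"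

text \<open>Meaningful for diagrams with exactly two components.\<close>

definition lk :: "'a diagram_scheme \<Rightarrow> (point \<Rightarrow> bool) \<Rightarrow> rat" where
  "lk D ori = (THE l. \<exists>A B. A \<noteq> B \<and> components D = {A, B} \<and> l = linking_number D ori A B)"


section \<open>Operations on tangle diagrams\<close>

definition elementary :: "piece \<Rightarrow> tangle" where
  "elementary x = \<lparr>pieces = [x], joins = {}, ends = (\<lambda>c. (0, c))\<rparr>"

definition shift :: "nat \<Rightarrow> point \<Rightarrow> point" where
  "shift m = (\<lambda>(k, c). (m + k, c))"

text \<open>\<open>beside S T\<close> places \<open>T\<close> to the right of \<open>S\<close>, and \<open>above S T\<close> places \<open>T\<close> below
  \<open>S\<close>; adjacent endpoints are joined.\<close>

definition beside :: "tangle \<Rightarrow> tangle \<Rightarrow> tangle" where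
  "beside S T = (let r = shift (length (pieces S)) in
    \<lparr>pieces = pieces S @ pieces T,
     joins = joins S \<union> map_prod r r ` joins T \<union>
       {(ends S NE, r (ends T NW)), (ends S SE, r (ends T SW))},
     ends = (\<lambda>c. if c \<in> {NW, SW} then ends S c else r (ends T c))\<rparr>)"

definition above :: "tangle \<Rightarrow> tangle \<Rightarrow> tangle" where
  "above S T = (let r = shift (length (pieces S)) in
    \<lparr>pieces = pieces S @ pieces T,
     joins = joins S \<union> map_prod r r ` joins T \<union>
       {(ends S SW, r (ends T NW)), (ends S SE, r (ends T NE))},
     ends = (\<lambda>c. if c \<in> {NW, NE} then ends S c else r (ends T c))\<rparr>)"

definition numerator_closure :: "tangle \<Rightarrow> diagram" where
  "numerator_closure T = \<lparr>pieces = pieces T,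
     joins = joins T \<union> {(ends T NW, ends T NE), (ends T SW, ends T SE)}\<rparr>"

definition denominator_closure :: "tangle \<Rightarrow> diagram" where
  "denominator_closure T = \<lparr>pieces = pieces T,
     joins = joins T \<union> {(ends T SW, ends T NW), (ends T SE, ends T NE)}\<rparr>"


section \<open>Rational tangles and their fractions\<close>

datatype ext_rat = Fin rat | Infinity

fun ext_inverse :: "ext_rat \<Rightarrow> ext_rat" where
  "ext_inverse (Fin x) = (if x = 0 then Infinity else Fin (1 / x))"
| "ext_inverse Infinity = Fin 0"

fun ext_add :: "ext_rat \<Rightarrow> rat \<Rightarrow> ext_rat" where
  "ext_add (Fin x) a = Fin (x + a)"
| "ext_add Infinity a = Infinity"

definition fraction :: "int \<Rightarrow> int \<Rightarrow> ext_rat" where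
  "fraction p q = (if q = 0 then Infinity else Fin (of_int p / of_int q))"

text \<open>\<open>rational_tangle T F\<close>: the diagram \<open>T\<close> arises from two horizontal arcs by horizontal and
  vertical twists, and the resulting fraction is \<open>F\<close>.\<close>

inductive rational_tangle :: "tangle \<Rightarrow> ext_rat \<Rightarrow> bool" where
  zero: "rational_tangle (elementary HArcs) (Fin 0)"
| horizontal_pos: "rational_tangle T F \<Longrightarrow>
    rational_tangle (beside T (elementary PosSlope)) (ext_add F 1)"
| horizontal_neg: "rational_tangle T F \<Longrightarrow>
    rational_tangle (beside T (elementary NegSlope)) (ext_add F (- 1))"
| vertical_pos: "rational_tangle T F \<Longrightarrow>
    rational_tangle (above T (elementary PosSlope)) (ext_inverse (ext_add (ext_inverse F) 1))"
| vertical_neg: "rational_tangle T F \<Longrightarrow>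
    rational_tangle (above T (elementary NegSlope)) (ext_inverse (ext_add (ext_inverse F) (- 1)))"

definition H_tangle :: "tangle \<Rightarrow> bool" where
  "H_tangle T \<longleftrightarrow> (ends T NW, ends T NE) \<in> connected_points T"


section \<open>Rational links and Montesinos links\<close>

definition rational_link_orientation :: "tangle \<Rightarrow> (point \<Rightarrow> bool) \<Rightarrow> bool" where
  "rational_link_orientation T ori \<longleftrightarrow> orientation (numerator_closure T) ori \<and>
    \<not> ori (ends T NE) \<and> ori (ends T NW) \<and> \<not> ori (ends T SW) \<and> ori (ends T SE)"

text \<open>The linking number of the oriented rational link \<open>R\<^bsub>p/q\<^esub>\<close>, for coprime \<open>p\<close>, \<open>q\<close> with \<open>p\<close>
  even. It is the common value for all rational tangles \<open>T\<close> of fraction \<open>p/q\<close>.\<close>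

definition lk_R :: "int \<Rightarrow> int \<Rightarrow> rat" where
  "lk_R p q = (THE l. \<exists>T ori. rational_tangle T (fraction p q) \<and>
     rational_link_orientation T ori \<and> l = lk (numerator_closure T) ori)"

text \<open>The empty stack is a pair of vertical arcs, so every stack carries a crossingless pair of
  vertical arcs at its bottom.\<close>

fun vertical_stack :: "tangle list \<Rightarrow> tangle" where
  "vertical_stack [] = elementary VArcs"
| "vertical_stack (T # Ts) = above T (vertical_stack Ts)"

definition half_twists :: "int \<Rightarrow> tangle list" where
  "half_twists e = replicate (nat \<bar>e\<bar>) (elementary (if e > 0 then PosSlope else NegSlope))"

definition montesinos :: "tangle list \<Rightarrow> int \<Rightarrow> diagram" where
  "montesinos Ts e = denominator_closure (vertical_stack (Ts @ half_twists e))"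

end

theory Submission
  imports Defs
begin

text \<open>
  A linking number is half a signed count of crossings, and in a Montesinos link this count splits
  over the tangles of the stack. A tangle that is not an \<open>H\<close>-tangle, like each half twist, carries
  its two strands from top to bottom. Hence between the two \<open>H\<close>-tangles \<open>T\<^sub>i\<close> and \<open>T\<^sub>j\<close> the stack
  consists of two strands joining the bottom arc of one to the top arc of the other: the link has
  one component on either side of this cyclic arrangement, the two strands of every other tangle
  lie on the same component, and only the crossings inside \<open>T\<^sub>i\<close> and \<open>T\<^sub>j\<close> between their two strands
  count. Inside \<open>T\<^sub>i\<close> they contribute what they contribute to \<open>R\<close>, up to the relative orientation
  of the two strands. Going from \<open>T\<^sub>i\<close> to \<open>T\<^sub>j\<close> the two strands are interchanged once by each
  \<open>D\<close>-tangle, that is for odd \<open>q\<^sub>k\<close>, and by each half twist; so going around both ways the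
  relative orientations in \<open>T\<^sub>i\<close> and \<open>T\<^sub>j\<close> compare by the parity of all the \<open>q\<^sub>k\<close> and \<open>e\<close>,
  where \<open>q\<^sub>i + q\<^sub>j\<close> is even.

  The other ingredient is that the linking number of \<open>R\<close> is determined by the fraction alone, for
  otherwise its definition would denote nothing. Instead of isotopy invariance, an explicit
  function of the fraction is used. The signed count \<open>w\<close> of the crossings between the two
  strands, with a suitable orientation for each of the types \<open>H\<close>, \<open>V\<close>, \<open>D\<close>, changes under a
  horizontal twist \<open>F \<mapsto> F + 1\<close> to \<open>- w\<close> for \<open>V\<close>-tangles (the new crossing is one of a
  strand with itself, and only the reference orientation changes) and to \<open>w + 1\<close> otherwise;
  vertical twists behave symmetrically. The Euclidean algorithm gives a function
  \<open>fraction_weight\<close> with the same behaviour, so \<open>w\<close> equals it by induction over the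
  construction of the tangle (\<open>rational_tangle_realizes\<close>).

  To keep connectivity out of these inductions, a tangle diagram is described by the labellings
  of its points by truth values which are constant (colourings) or alternating (orientations)
  along its curves: two points are connected iff all colourings agree on them. The predicate
  \<open>realizes\<close> collects what the ends know about the labellings of the diagram and the count
  \<open>w\<close>, and \<open>realizes_glue\<close> reduces its behaviour under gluing to a finite check.
\<close>

section \<open>Labellings\<close>

text \<open>
  With \<open>b = False\<close> these are the colourings that are constant on components, with \<open>b = True\<close>
  the orientations. Both restrict to parts of a diagram and extend from parts in the same way, so
  they are handled together.
\<close>

definition labelling :: "bool \<Rightarrow> 'a diagram_scheme \<Rightarrow> (point \<Rightarrow> bool) \<Rightarrow> bool" where
  "labelling b D f \<longleftrightarrow> (\<forall>(x, y) \<in> strands D \<union> joins D. (f x \<noteq> f y) = b)"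

lemma orientation_iff_labelling: "orientation D ori \<longleftrightarrow> labelling True D ori"
  by (auto simp: orientation_def labelling_def)

lemma across_across [simp]: "across x (across x c) = c"
  by (cases x; cases c) auto

lemma sym_strands: "sym (strands D)"
proof (rule symI)
  fix x y assume "(x, y) \<in> strands D"
  then obtain k c where k: "k < length (pieces D)" "x = (k, c)" "y = (k, across (pieces D ! k) c)"
    by (auto simp: strands_def)
  then have "y = (k, across (pieces D ! k) c) \<and> x = (k, across (pieces D ! k) (across (pieces D ! k) c))"
    by simp
  then show "(y, x) \<in> strands D"
    using k(1) unfolding strands_def by blast
qed

lemma sym_connected_points: "sym (connected_points D)"
  unfolding connected_points_def using sym_strands[of D]
  by (intro sym_rtrancl) (auto simp: sym_def)

lemma trans_connected_points: "trans (connected_points D)"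
  unfolding connected_points_def by (rule trans_rtrancl)

lemma connected_points_imp_same_label:
  assumes "(x, y) \<in> connected_points D" "labelling False D f"
  shows "f x = f y"
  using assms(1) unfolding connected_points_def
proof (induction rule: rtrancl_induct)
  case (step y z)
  then show ?case using assms(2) by (auto simp: labelling_def)
qed simp

text \<open>
  Colourings detect connectivity: the indicator of a union of components is one, which is the
  converse of \<open>connected_points_imp_same_label\<close>.
\<close>

lemma labelling_reachable: "labelling False D (\<lambda>x. \<exists>u\<in>U. (u, x) \<in> connected_points D)"
proof -
  have "(x, y) \<in> connected_points D \<and> (y, x) \<in> connected_points D"
    if "(x, y) \<in> strands D \<union> joins D" for x y
  proof -
    have "(x, y) \<in> connected_points D"
      using that unfolding connected_points_def by (intro r_into_rtrancl) auto
    then show ?thesis using sym_connected_points by (metis symD)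
  qed
  then show ?thesis
    unfolding labelling_def using transD[OF trans_connected_points[of D]] by blast
qed

lemma labelling_cong:
  assumes "joins D \<subseteq> points D \<times> points D" "\<And>x. x \<in> points D \<Longrightarrow> f x = g x"
  shows "labelling b D f \<longleftrightarrow> labelling b D g"
proof -
  have "x \<in> points D \<and> y \<in> points D" if "(x, y) \<in> strands D \<union> joins D" for x y
    using that assms(1) by (auto simp: strands_def points_def)
  then have "(f x \<noteq> f y) = b \<longleftrightarrow> (g x \<noteq> g y) = b" if "(x, y) \<in> strands D \<union> joins D" for x y
    using that assms(2) by metis
  then show ?thesis unfolding labelling_def by blast
qed

section \<open>Linking numbers of two-component diagrams\<close>

text \<open>
  If \<open>\<chi>\<close> is the indicator of one of two components, this is twice their linking number. Unlike
  the linking number it makes sense for parts of a diagram, over which it is additive.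
\<close>

definition signed_crossings ::
    "'a diagram_scheme \<Rightarrow> (point \<Rightarrow> bool) \<Rightarrow> (point \<Rightarrow> bool) \<Rightarrow> rat" where
  "signed_crossings D \<chi> ori = (\<Sum>k<length (pieces D).
     if pieces D ! k \<in> {PosSlope, NegSlope} \<and> \<chi> (k, NW) \<noteq> \<chi> (k, NE)
     then crossing_sign D ori k else 0)"

lemma signed_crossings_cong:
  assumes "pieces D = pieces E"
  shows "signed_crossings D \<chi> ori = signed_crossings E \<chi> ori"
  by (simp add: signed_crossings_def crossing_sign_def assms cong: if_cong)

lemma linking_number_commute: "linking_number D ori A B = linking_number D ori B A"
proof -
  have "crossings_between D A B = crossings_between D B A"
    by (auto simp: crossings_between_def)
  then show ?thesis by (simp add: linking_number_def)
qed

text \<open>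
  The number of components and the linking number are read off from colourings alone: a colouring
  separating \<open>u\<close> from \<open>v\<close> shows that there are at least two components, and a third one would
  have a colouring, the indicator of those of \<open>u\<close> and \<open>v\<close>, that is not constant.
\<close>

lemma two_components:
  assumes u: "u \<in> points D" and v: "v \<in> points D"
    and separated: "labelling False D \<chi>\<^sub>0" "\<chi>\<^sub>0 u \<noteq> \<chi>\<^sub>0 v"
    and exhausted: "\<And>\<chi>. labelling False D \<chi> \<Longrightarrow> \<chi> u \<Longrightarrow> \<chi> v \<Longrightarrow> \<forall>x\<in>points D. \<chi> x"
  shows "card (components D) = 2"
    and "\<exists>\<chi>. labelling False D \<chi> \<and> \<chi> u \<and> \<not> \<chi> v \<and> (\<forall>ori. lk D ori = signed_crossings D \<chi> ori / 2)"
proof -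
  define A where "A = connected_points D `` {u}"
  define B where "B = connected_points D `` {v}"
  have refl: "(x, x) \<in> connected_points D" for x
    by (simp add: connected_points_def)
  note tr = transD[OF trans_connected_points[of D]] and sy = symD[OF sym_connected_points[of D]]
  have uv: "(u, v) \<notin> connected_points D"
    using connected_points_imp_same_label separated by blast
  have disj: "x \<notin> A \<or> x \<notin> B" for x
    using uv tr sy unfolding A_def B_def by blast
  have cover: "x \<in> A \<or> x \<in> B" if "x \<in> points D" for x
    using exhausted[OF labelling_reachable[of D "{u, v}"]] refl that
    by (auto simp: A_def B_def)
  have cls: "connected_points D `` {x} = (if x \<in> A then A else B)" if "x \<in> points D" for x
  proof -
    have "(w, x) \<in> connected_points D \<Longrightarrow> connected_points D `` {x} = connected_points D `` {w}" for w
      using tr sy by blast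
    note this[of u] this[of v]
    then show ?thesis using cover[OF that] unfolding A_def B_def by (cases "x \<in> A") (simp_all add: A_def)
  qed
  have uA: "u \<in> A" and vB: "v \<in> B" by (auto simp: A_def B_def refl)
  then have "A \<noteq> B" using disj by blast
  have comps: "components D = {A, B}"
  proof
    show "components D \<subseteq> {A, B}"
      using cls unfolding components_def quotient_def by (auto split: if_splits simp del: split_paired_All)
    show "{A, B} \<subseteq> components D"
      using u v by (auto simp: components_def A_def B_def intro: quotientI)
  qed
  show "card (components D) = 2"
    using \<open>A \<noteq> B\<close> by (simp add: comps)
  let ?\<chi> = "\<lambda>x. x \<in> A"
  have lkA: "lk D ori = linking_number D ori A B" for ori
    unfolding lk_def
  proof (rule the_equality)
    show "\<exists>A' B'. A' \<noteq> B' \<and> components D = {A', B'} \<and>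
        linking_number D ori A B = linking_number D ori A' B'"
      using comps \<open>A \<noteq> B\<close> by blast
    show "l = linking_number D ori A B"
      if "\<exists>A' B'. A' \<noteq> B' \<and> components D = {A', B'} \<and> l = linking_number D ori A' B'" for l
      using that comps linking_number_commute[of D ori A B] by (auto simp: doubleton_eq_iff)
  qed
  have "linking_number D ori A B = signed_crossings D ?\<chi> ori / 2" for ori
  proof -
    have pt: "(k, c) \<in> A \<longleftrightarrow> (k, c) \<notin> B" if "k < length (pieces D)" for k c
      using cover[of "(k, c)"] disj[of "(k, c)"] that by (auto simp: points_def)
    have "crossings_between D A B = {k \<in> {..<length (pieces D)}.
        pieces D ! k \<in> {PosSlope, NegSlope} \<and> ?\<chi> (k, NW) \<noteq> ?\<chi> (k, NE)}"
      using pt by (auto simp: crossings_between_def crossings_def)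
    then show ?thesis
      by (simp only: linking_number_def signed_crossings_def sum.inter_filter finite_lessThan)
  qed
  moreover have "labelling False D ?\<chi>"
    using labelling_reachable[of D "{u}"] by (simp add: A_def)
  ultimately show "\<exists>\<chi>. labelling False D \<chi> \<and> \<chi> u \<and> \<not> \<chi> v \<and>
      (\<forall>ori. lk D ori = signed_crossings D \<chi> ori / 2)"
    using uA vB disj[of v] lkA by (intro exI[of _ ?\<chi>]) auto
qed

section \<open>Tangles seen from their ends\<close>

text \<open>
  The strand from NW ends at NE, at SW or at SE: these are the types \<open>H\<close>, \<open>V\<close> and \<open>D\<close>.
\<close>

datatype kind = Horizontal | Vertical | Diagonal

fun mate :: "kind \<Rightarrow> corner \<Rightarrow> corner" where
  "mate Horizontal = across HArcs"
| "mate Vertical = across VArcs"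
| "mate Diagonal = diagonal"

definition matches :: "bool \<Rightarrow> kind \<Rightarrow> (corner \<Rightarrow> bool) \<Rightarrow> bool" where
  "matches b s g \<longleftrightarrow> (\<forall>c. (g c \<noteq> g (mate s c)) = b)"

text \<open>
  Here \<open>g\<close> colours and \<open>h\<close> orients the four ends. Nothing is counted if the two strands have the
  same colour; otherwise reversing one strand changes all signs, so a reference orientation must
  be chosen for each kind. For \<open>Diagonal\<close> tangles \<open>h NW \<noteq> h SW\<close> is equivalent to \<open>h NW = h NE\<close>,
  so this choice is the one of the \<open>Horizontal\<close> and also the one of the \<open>Vertical\<close> kind. That is
  why a twist adds its sign to the count whenever it crosses different strands, be it horizontal
  or vertical.
\<close>

definition weight_sign :: "kind \<Rightarrow> (corner \<Rightarrow> bool) \<Rightarrow> (corner \<Rightarrow> bool) \<Rightarrow> rat" where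
  "weight_sign s g h =
    (if \<forall>c. g c = g NW then 0
     else if (if s = Vertical then h NW = h NE else h NW \<noteq> h SW) then 1 else - 1)"

text \<open>
  The behaviour of a tangle as seen from its ends. The labellings of the ends that extend to the
  diagram are those that match the strands of kind \<open>s\<close>; a colouring that is constant on the ends
  is constant, which says that there are no closed components; and \<open>w\<close> is the signed count of
  crossings between the two strands.
\<close>

definition realizes :: "tangle \<Rightarrow> kind \<Rightarrow> rat \<Rightarrow> bool" where
  "realizes T s w \<longleftrightarrow>
    joins T \<subseteq> points T \<times> points T \<and> (\<forall>c. ends T c \<in> points T) \<and>
    (\<forall>b f. labelling b T f \<longrightarrow> matches b s (\<lambda>c. f (ends T c))) \<and>
    (\<forall>b g. matches b s g \<longrightarrow> (\<exists>f. labelling b T f \<and> (\<forall>c. f (ends T c) = g c))) \<and>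
    (\<forall>\<chi> a. labelling False T \<chi> \<longrightarrow> (\<forall>c. \<chi> (ends T c) = a) \<longrightarrow> (\<forall>x\<in>points T. \<chi> x = a)) \<and>
    (\<forall>\<chi> ori. labelling False T \<chi> \<longrightarrow> labelling True T ori \<longrightarrow>
      signed_crossings T \<chi> ori = weight_sign s (\<lambda>c. \<chi> (ends T c)) (\<lambda>c. ori (ends T c)) * w)"

lemma realizesI:
  assumes "joins T \<subseteq> points T \<times> points T" "\<And>c. ends T c \<in> points T"
    and "\<And>b f. labelling b T f \<Longrightarrow> matches b s (\<lambda>c. f (ends T c))"
    and "\<And>b g. matches b s g \<Longrightarrow> \<exists>f. labelling b T f \<and> (\<forall>c. f (ends T c) = g c)"
    and "\<And>\<chi> a. labelling False T \<chi> \<Longrightarrow> \<forall>c. \<chi> (ends T c) = a \<Longrightarrow> \<forall>x\<in>points T. \<chi> x = a"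
    and "\<And>\<chi> ori. labelling False T \<chi> \<Longrightarrow> labelling True T ori \<Longrightarrow>
      signed_crossings T \<chi> ori = weight_sign s (\<lambda>c. \<chi> (ends T c)) (\<lambda>c. ori (ends T c)) * w"
  shows "realizes T s w"
  unfolding realizes_def by (intro conjI allI impI; fact assms)

lemma realizesD:
  assumes "realizes T s w"
  shows realizes_joins: "joins T \<subseteq> points T \<times> points T"
    and realizes_ends: "ends T c \<in> points T"
    and realizes_matches: "labelling b T f \<Longrightarrow> matches b s (\<lambda>c. f (ends T c))"
    and realizes_extend: "matches b s g \<Longrightarrow> \<exists>f. labelling b T f \<and> (\<forall>c. f (ends T c) = g c)"
    and realizes_mono:
      "labelling False T \<chi> \<Longrightarrow> \<forall>c. \<chi> (ends T c) = a \<Longrightarrow> \<forall>x\<in>points T. \<chi> x = a"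
    and realizes_weight: "labelling False T \<chi> \<Longrightarrow> labelling True T ori \<Longrightarrow>
      signed_crossings T \<chi> ori = weight_sign s (\<lambda>c. \<chi> (ends T c)) (\<lambda>c. ori (ends T c)) * w"
  using assms unfolding realizes_def by simp_all

lemma all_corner: "(\<forall>c. P c) \<longleftrightarrow> P NW \<and> P NE \<and> P SW \<and> P SE"
  by (metis corner.exhaust)

lemma matches_simps:
  "matches b Horizontal g \<longleftrightarrow> g NE = (g NW \<noteq> b) \<and> g SE = (g SW \<noteq> b)"
  "matches b Vertical g \<longleftrightarrow> g SW = (g NW \<noteq> b) \<and> g SE = (g NE \<noteq> b)"
  "matches b Diagonal g \<longleftrightarrow> g SE = (g NW \<noteq> b) \<and> g SW = (g NE \<noteq> b)"
  unfolding matches_def all_corner mate.simps across.simps diagonal.simps corner.case by blast+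

lemma realizes_elementary:
  assumes shape: "mate s = across x"
    and weight: "w = (case x of PosSlope \<Rightarrow> 1 | NegSlope \<Rightarrow> - 1 | _ \<Rightarrow> 0)"
  shows "realizes (elementary x) s w"
proof -
  have [simp]: "pieces (elementary x) = [x]" "joins (elementary x) = {}"
    "ends (elementary x) c = (0, c)" for c
    by (simp_all add: elementary_def)
  have strands: "strands (elementary x) = {((0, c), (0, across x c)) | c. True}"
    by (auto simp: strands_def)
  have lab: "labelling b (elementary x) f \<longleftrightarrow> matches b s (\<lambda>c. f (0, c))" for b f
    unfolding labelling_def strands matches_def shape by auto
  have extend: "\<exists>f. matches b s (\<lambda>c. f (0::nat, c)) \<and> (\<forall>c. f (0, c) = g c)"
    if "matches b s g" for b g
    using that by (intro exI[of _ "\<lambda>(k, c). g c"]) auto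
  have crossing: "signed_crossings (elementary x) \<chi> ori =
      weight_sign s (\<lambda>c. \<chi> (0, c)) (\<lambda>c. ori (0, c)) * w"
    if \<chi>: "matches False s (\<lambda>c. \<chi> (0, c))" and ori: "matches True s (\<lambda>c. ori (0, c))" for \<chi> ori
  proof (cases "x \<in> {PosSlope, NegSlope}")
    case True
    then have "mate s SW = NE" using shape by auto
    then have "s = Diagonal" by (cases s) auto
    moreover have "\<chi> (0, SE) = \<chi> (0, NW)" "\<chi> (0, SW) = \<chi> (0, NE)"
      "ori (0, SE) = (\<not> ori (0, NW))" "ori (0, SW) = (\<not> ori (0, NE))"
      using \<chi> ori unfolding \<open>s = Diagonal\<close> matches_simps by simp_all
    ultimately show ?thesis
      using True weight
      by (cases "ori (0, NW)"; cases "ori (0, NE)"; cases "\<chi> (0, NW)"; cases "\<chi> (0, NE)")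
        (auto simp: signed_crossings_def crossing_sign_def weight_sign_def all_corner)
  next
    case False
    then have "w = 0" using weight by (cases x) auto
    then show ?thesis using False by (simp add: signed_crossings_def)
  qed
  show ?thesis
  proof (rule realizesI)
    show "\<exists>f. labelling b (elementary x) f \<and> (\<forall>c. f (ends (elementary x) c) = g c)"
      if "matches b s g" for b g
      using extend[OF that] by (simp add: lab)
    show "signed_crossings (elementary x) \<chi> ori = weight_sign s
        (\<lambda>c. \<chi> (ends (elementary x) c)) (\<lambda>c. ori (ends (elementary x) c)) * w"
      if "labelling False (elementary x) \<chi>" "labelling True (elementary x) ori" for \<chi> ori
      using crossing that by (simp add: lab)
  qed (auto simp: points_def lab)
qed

lemma realizes_elementary_pieces:
  "realizes (elementary HArcs) Horizontal 0"
  "realizes (elementary VArcs) Vertical 0"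
  "realizes (elementary PosSlope) Diagonal 1"
  "realizes (elementary NegSlope) Diagonal (- 1)"
  by (rule realizes_elementary; (intro ext)?; simp)+

section \<open>Gluing tangles\<close>

text \<open>
  The common form of \<open>beside\<close> and \<open>above\<close>: the pairs in \<open>J\<close> say which ends are joined, and \<open>A\<close>
  which of the four ends of the result are those of \<open>S\<close>.
\<close>

definition glue :: "(corner \<times> corner) set \<Rightarrow> corner set \<Rightarrow> tangle \<Rightarrow> tangle \<Rightarrow> tangle" where
  "glue J A S T = (let r = shift (length (pieces S)) in
    \<lparr>pieces = pieces S @ pieces T,
     joins = joins S \<union> map_prod r r ` joins T \<union> (\<lambda>(c, d). (ends S c, r (ends T d))) ` J,
     ends = (\<lambda>c. if c \<in> A then ends S c else r (ends T c))\<rparr>)"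

lemma beside_eq_glue: "beside = glue {(NE, NW), (SE, SW)} {NW, SW}"
  by (intro ext) (simp add: beside_def glue_def Let_def)

lemma above_eq_glue: "above = glue {(SW, NW), (SE, NE)} {NW, NE}"
  by (intro ext) (simp add: above_def glue_def Let_def)

lemma strands_append:
  assumes "pieces D = pieces S @ pieces T"
  shows "strands D = strands S \<union> map_prod (shift (length (pieces S))) (shift (length (pieces S))) ` strands T"
    (is "_ = _ \<union> ?r ` _")
proof (intro set_eqI iffI)
  fix z assume "z \<in> strands D"
  then obtain k c where k: "k < length (pieces S) + length (pieces T)"
    and z: "z = ((k, c), (k, across ((pieces S @ pieces T) ! k) c))"
    by (auto simp: strands_def assms)
  show "z \<in> strands S \<union> ?r ` strands T"
  proof (cases "k < length (pieces S)")
    case True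
    then show ?thesis using z by (auto simp: strands_def nth_append)
  next
    case False
    define l where "l = k - length (pieces S)"
    have "z = ?r ((l, c), (l, across (pieces T ! l) c))" "l < length (pieces T)"
      using False k z by (auto simp: l_def nth_append shift_def)
    then show ?thesis unfolding strands_def by blast
  qed
next
  fix z assume "z \<in> strands S \<union> ?r ` strands T"
  then show "z \<in> strands D"
    by (auto simp: strands_def assms nth_append shift_def)
qed

lemma labelling_glue:
  fixes S T :: tangle
  defines "r \<equiv> shift (length (pieces S))"
  shows "labelling b (glue J A S T) f \<longleftrightarrow>
    labelling b S f \<and> labelling b T (\<lambda>x. f (r x)) \<and>
    (\<forall>(c, d) \<in> J. (f (ends S c) \<noteq> f (r (ends T d))) = b)"
proof -
  have "strands (glue J A S T) = strands S \<union> map_prod r r ` strands T"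
    unfolding r_def by (rule strands_append) (simp add: glue_def Let_def)
  moreover have "joins (glue J A S T) =
      joins S \<union> map_prod r r ` joins T \<union> (\<lambda>(c, d). (ends S c, r (ends T d))) ` J"
    by (simp add: glue_def Let_def r_def)
  ultimately show ?thesis
    unfolding labelling_def by (auto simp: ball_Un)
qed

lemma points_glue:
  "points (glue J A S T) = points S \<union> shift (length (pieces S)) ` points T"
proof (intro set_eqI iffI)
  fix x assume x: "x \<in> points (glue J A S T)"
  obtain k c where [simp]: "x = (k, c)" by (cases x)
  show "x \<in> points S \<union> shift (length (pieces S)) ` points T"
  proof (cases "k < length (pieces S)")
    case False
    then have "x = shift (length (pieces S)) (k - length (pieces S), c)"
      "(k - length (pieces S), c) \<in> points T"
      using x by (auto simp: shift_def points_def glue_def Let_def)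
    then show ?thesis by blast
  qed (use x in \<open>auto simp: points_def\<close>)
next
  fix x assume "x \<in> points S \<union> shift (length (pieces S)) ` points T"
  then show "x \<in> points (glue J A S T)"
    by (auto simp: points_def glue_def Let_def shift_def)
qed

lemma signed_crossings_glue:
  fixes S T :: tangle
  defines "r \<equiv> shift (length (pieces S))"
  shows "signed_crossings (glue J A S T) \<chi> ori =
    signed_crossings S \<chi> ori + signed_crossings T (\<lambda>x. \<chi> (r x)) (\<lambda>x. ori (r x))"
proof -
  let ?G = "glue J A S T" and ?m = "length (pieces S)" and ?n = "length (pieces T)"
  have pieces: "pieces ?G = pieces S @ pieces T"
    by (simp add: glue_def Let_def)
  have sgnS: "crossing_sign ?G ori k = crossing_sign S ori k" if "k < ?m" for k
    using that by (simp add: crossing_sign_def pieces nth_append)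
  have sgnT: "crossing_sign ?G ori (k + ?m) = crossing_sign T (\<lambda>x. ori (r x)) k" for k
    by (simp add: crossing_sign_def pieces nth_append r_def shift_def add.commute)
  have split: "sum h {..<?m + ?n} = sum h {..<?m} + (\<Sum>k<?n. h (k + ?m))" for h :: "nat \<Rightarrow> rat"
    using sum.atLeastLessThan_concat[of 0 ?m "?m + ?n" h] sum.shift_bounds_nat_ivl[of h 0 ?m ?n]
    by (simp add: atLeast0LessThan add.commute)
  show ?thesis
    unfolding signed_crossings_def pieces length_append split
    by (intro arg_cong2[where f = "(+)"] sum.cong)
      (auto simp: sgnS sgnT nth_append r_def shift_def add.commute)
qed

text \<open>
  Labellings of a glued tangle are pairs of labellings that fit at the joined ends, and signed
  crossings add up. So everything about the glued tangle follows from assertions about truth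
  values at the eight ends, which for concrete kinds are a finite check.
\<close>

lemma realizes_glue:
  assumes S: "realizes S s u" and T: "realizes T t v"
    and match: "\<And>b g h. matches b s g \<Longrightarrow> matches b t h \<Longrightarrow>
        \<forall>(c, d)\<in>J. (g c \<noteq> h d) = b \<Longrightarrow> matches b r (\<lambda>c. if c \<in> A then g c else h c)"
    and extend: "\<And>b k. matches b r k \<Longrightarrow> \<exists>g h. matches b s g \<and> matches b t h \<and>
        (\<forall>(c, d)\<in>J. (g c \<noteq> h d) = b) \<and> (\<forall>c. k c = (if c \<in> A then g c else h c))"
    and mono: "\<And>g h a. matches False s g \<Longrightarrow> matches False t h \<Longrightarrow> \<forall>(c, d)\<in>J. g c = h d \<Longrightarrow>
        \<forall>c. (if c \<in> A then g c else h c) = a \<Longrightarrow> (\<forall>c. g c = a) \<and> (\<forall>c. h c = a)"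
    and weight: "\<And>g h g' h'. matches False s g \<Longrightarrow> matches False t h \<Longrightarrow> \<forall>(c, d)\<in>J. g c = h d \<Longrightarrow>
        matches True s g' \<Longrightarrow> matches True t h' \<Longrightarrow> \<forall>(c, d)\<in>J. g' c \<noteq> h' d \<Longrightarrow>
        weight_sign s g g' * u + weight_sign t h h' * v =
        weight_sign r (\<lambda>c. if c \<in> A then g c else h c) (\<lambda>c. if c \<in> A then g' c else h' c) * w"
  shows "realizes (glue J A S T) r w"
proof -
  let ?G = "glue J A S T" and ?r = "shift (length (pieces S))"
  have ends: "ends ?G = (\<lambda>c. if c \<in> A then ends S c else ?r (ends T c))"
    by (simp add: glue_def Let_def)
  have J: "joins ?G =
      joins S \<union> map_prod ?r ?r ` joins T \<union> (\<lambda>(c, d). (ends S c, ?r (ends T d))) ` J"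
    by (simp add: glue_def Let_def)
  have at_ends: "(\<lambda>c. f (ends ?G c)) =
      (\<lambda>c. if c \<in> A then f (ends S c) else f (?r (ends T c)))" for f :: "point \<Rightarrow> bool"
    by (auto simp: ends)
  have labS: "labelling b S f" and labT: "labelling b T (\<lambda>x. f (?r x))"
    and labJ: "\<forall>(c, d)\<in>J. (f (ends S c) \<noteq> f (?r (ends T d))) = b" if "labelling b ?G f" for b f
    using that by (simp_all add: labelling_glue)
  have matchS: "matches b s (\<lambda>c. f (ends S c))"
    and matchT: "matches b t (\<lambda>c. f (?r (ends T c)))" if "labelling b ?G f" for b f
    using realizes_matches[OF S labS[OF that]] realizes_matches[OF T labT[OF that]] by simp_all
  show ?thesis
  proof (rule realizesI)
    show "joins ?G \<subseteq> points ?G \<times> points ?G"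
      unfolding J points_glue
      using realizes_joins[OF S] realizes_joins[OF T] realizes_ends[OF S] realizes_ends[OF T] by auto
    show "ends ?G c \<in> points ?G" for c
      unfolding ends points_glue using realizes_ends[OF S] realizes_ends[OF T] by auto
    show "matches b r (\<lambda>c. f (ends ?G c))" if "labelling b ?G f" for b f
      unfolding at_ends using matchS[OF that] matchT[OF that] labJ[OF that] by (rule match)
  next
    fix b k assume "matches b r k"
    obtain g h where gh: "matches b s g" "matches b t h" "\<forall>(c, d)\<in>J. (g c \<noteq> h d) = b"
      and k: "\<forall>c. k c = (if c \<in> A then g c else h c)"
      using extend[OF \<open>matches b r k\<close>] by (elim exE conjE) (rule that; assumption)
    obtain fS where fS: "labelling b S fS" "\<forall>c. fS (ends S c) = g c"
      using realizes_extend[OF S gh(1)] by auto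
    obtain fT where fT: "labelling b T fT" "\<forall>c. fT (ends T c) = h c"
      using realizes_extend[OF T gh(2)] by auto
    define f where "f = (\<lambda>(k, c). if k < length (pieces S) then fS (k, c)
      else fT (k - length (pieces S), c))"
    have onS: "f x = fS x" if "x \<in> points S" for x
      using that by (auto simp: f_def points_def)
    have onT: "f (?r x) = fT x" for x
      by (auto simp: f_def shift_def split: prod.splits)
    have "labelling b S f"
      using fS(1) labelling_cong[OF realizes_joins[OF S] onS] by simp
    moreover have "f (ends S c) = g c" for c
      using onS[OF realizes_ends[OF S]] fS(2) by simp
    ultimately have "labelling b ?G f \<and> (\<forall>c. f (ends ?G c) = k c)"
      using fT gh(3) k by (simp add: labelling_glue onT ends)
    then show "\<exists>f. labelling b ?G f \<and> (\<forall>c. f (ends ?G c) = k c)"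
      by (rule exI[of _ f])
  next
    fix \<chi> a assume lab: "labelling False ?G \<chi>" and const: "\<forall>c. \<chi> (ends ?G c) = a"
    have "\<forall>(c, d)\<in>J. \<chi> (ends S c) = \<chi> (?r (ends T d))"
      using labJ[OF lab] by simp
    moreover have "\<forall>c. (if c \<in> A then \<chi> (ends S c) else \<chi> (?r (ends T c))) = a"
      using const by (simp add: ends if_distrib)
    ultimately have const': "(\<forall>c. \<chi> (ends S c) = a) \<and> (\<forall>c. \<chi> (?r (ends T c)) = a)"
      by (rule mono[OF matchS[OF lab] matchT[OF lab]])
    have "\<forall>x\<in>points S. \<chi> x = a"
      by (rule realizes_mono[OF S labS[OF lab] conjunct1[OF const']])
    moreover have "\<forall>x\<in>points T. \<chi> (?r x) = a"
      by (rule realizes_mono[OF T labT[OF lab] conjunct2[OF const']])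
    ultimately show "\<forall>x\<in>points ?G. \<chi> x = a" by (auto simp: points_glue)
  next
    fix \<chi> ori assume lab: "labelling False ?G \<chi>" "labelling True ?G ori"
    have "\<forall>(c, d)\<in>J. \<chi> (ends S c) = \<chi> (?r (ends T d))"
      "\<forall>(c, d)\<in>J. ori (ends S c) \<noteq> ori (?r (ends T d))"
      using labJ[OF lab(1)] labJ[OF lab(2)] by simp_all
    from weight[OF matchS[OF lab(1)] matchT[OF lab(1)] this(1)
        matchS[OF lab(2)] matchT[OF lab(2)] this(2)]
    show "signed_crossings ?G \<chi> ori =
        weight_sign r (\<lambda>c. \<chi> (ends ?G c)) (\<lambda>c. ori (ends ?G c)) * w"
      unfolding signed_crossings_glue at_ends
        realizes_weight[OF S labS[OF lab(1)] labS[OF lab(2)]]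
        realizes_weight[OF T labT[OF lab(1)] labT[OF lab(2)]] .
  qed
qed

text \<open>
  Turns the search for the end labels of the two parts into a search through truth values.
\<close>

lemma ex_corner_fun:
  "(\<exists>g :: corner \<Rightarrow> bool. P g) \<longleftrightarrow>
   (\<exists>a b c d. P (\<lambda>x. case x of NW \<Rightarrow> a | NE \<Rightarrow> b | SW \<Rightarrow> c | SE \<Rightarrow> d))"
proof
  assume "\<exists>g :: corner \<Rightarrow> bool. P g"
  then obtain g where "P g" ..
  moreover have "g = (\<lambda>x. case x of NW \<Rightarrow> g NW | NE \<Rightarrow> g NE | SW \<Rightarrow> g SW | SE \<Rightarrow> g SE)"
  proof
    show "g x = (case x of NW \<Rightarrow> g NW | NE \<Rightarrow> g NE | SW \<Rightarrow> g SW | SE \<Rightarrow> g SE)" for x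
      by (cases x) auto
  qed
  ultimately have "P (\<lambda>x. case x of NW \<Rightarrow> g NW | NE \<Rightarrow> g NE | SW \<Rightarrow> g SW | SE \<Rightarrow> g SE)"
    by (rule back_subst[of P])
  then show "\<exists>a b c d. P (\<lambda>x. case x of NW \<Rightarrow> a | NE \<Rightarrow> b | SW \<Rightarrow> c | SE \<Rightarrow> d)"
    by (intro exI)
qed blast


definition above_kind :: "kind \<Rightarrow> kind \<Rightarrow> kind" where
  "above_kind s t = (if s = Horizontal \<or> t = Horizontal then Horizontal
     else if s = t then Vertical else Diagonal)"

text \<open>
  Below (or above) a horizontal tangle, both strands of the other tangle continue the same strand
  of the first and so contribute nothing; if they cross over, they exchange the two ends of that
  strand, which turns the reference orientation into the opposite one. Two horizontal tangles are
  left out: stacking them produces a closed component.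
\<close>

definition above_weight :: "kind \<Rightarrow> kind \<Rightarrow> rat \<Rightarrow> rat \<Rightarrow> rat" where
  "above_weight s t u v =
    (if s = Horizontal then if t = Diagonal then - u else u
     else if t = Horizontal then if s = Diagonal then - v else v
     else u + v)"

definition beside_kind :: "kind \<Rightarrow> kind" where
  "beside_kind s = (case s of Horizontal \<Rightarrow> Diagonal | Diagonal \<Rightarrow> Horizontal | Vertical \<Rightarrow> Vertical)"

lemmas kind_check = matches_simps all_corner ex_corner_fun ex_bool_eq weight_sign_def
  above_kind_def above_weight_def beside_kind_def

text \<open>
  The labels of \<open>S\<close> at NW, NE and SW and one of those of \<open>T\<close> determine the labels of all eight
  ends, through the kinds and the joins; each claim is checked by running through their values.
\<close>

lemma realizes_above:
  assumes "realizes S s u" "realizes T t v" "s \<noteq> Horizontal \<or> t \<noteq> Horizontal"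
  shows "realizes (above S T) (above_kind s t) (above_weight s t u v)"
    (is "realizes _ ?r ?w")
proof -
  let ?J = "{(SW, NW), (SE, NE)}" and ?A = "{NW, NE}"
  show ?thesis
    unfolding above_eq_glue
  proof (rule realizes_glue[OF assms(1,2)])
    fix b g h
    assume *: "matches b s g" "matches b t h" "\<forall>(c, d)\<in>?J. (g c \<noteq> h d) = b"
    show "matches b ?r (\<lambda>c. if c \<in> ?A then g c else h c)"
      by (insert * assms(3); cases s; cases t; cases b;
        cases "g NW"; cases "g NE"; cases "g SW"; cases "h SW"; simp add: kind_check)
  next
    fix b k
    assume *: "matches b ?r k"
    show "\<exists>g h. matches b s g \<and> matches b t h \<and>
        (\<forall>(c, d)\<in>?J. (g c \<noteq> h d) = b) \<and> (\<forall>c. k c = (if c \<in> ?A then g c else h c))"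
      by (insert * assms(3); cases s; cases t; cases b;
        cases "k NW"; cases "k NE"; cases "k SW"; simp add: kind_check)
  next
    fix g h a
    assume *: "matches False s g" "matches False t h" "\<forall>(c, d)\<in>?J. g c = h d"
      "\<forall>c. (if c \<in> ?A then g c else h c) = a"
    show "(\<forall>c. g c = a) \<and> (\<forall>c. h c = a)"
      by (insert * assms(3); cases s; cases t; cases a;
        cases "g NW"; cases "g NE"; cases "g SW"; cases "h SW"; simp add: kind_check)
  next
    fix g h g' h'
    assume *: "matches False s g" "matches False t h" "\<forall>(c, d)\<in>?J. g c = h d"
      "matches True s g'" "matches True t h'" "\<forall>(c, d)\<in>?J. g' c \<noteq> h' d"
    show "weight_sign s g g' * u + weight_sign t h h' * v =
        weight_sign ?r (\<lambda>c. if c \<in> ?A then g c else h c) (\<lambda>c. if c \<in> ?A then g' c else h' c) * ?w"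
      by (insert * assms(3); cases s; cases t;
        cases "g NW"; cases "g NE"; cases "g SW"; cases "h SW";
        cases "g' NW"; cases "g' NE"; cases "g' SW"; cases "h' SW"; simp add: kind_check)
  qed
qed

text \<open>
  A crossing added at the right of a vertical tangle is a crossing of one strand with itself. It
  exchanges the ends of this strand, which reverses the reference orientation.
\<close>

lemma realizes_beside_Diagonal:
  assumes "realizes S s u" "realizes T Diagonal v"
  shows "realizes (beside S T) (beside_kind s) (if s = Vertical then - u else u + v)"
    (is "realizes _ ?r ?w")
proof -
  let ?J = "{(NE, NW), (SE, SW)}" and ?A = "{NW, SW}"
  show ?thesis
    unfolding beside_eq_glue
  proof (rule realizes_glue[OF assms(1,2)])
    fix b g h
    assume *: "matches b s g" "matches b Diagonal h" "\<forall>(c, d)\<in>?J. (g c \<noteq> h d) = b"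
    show "matches b ?r (\<lambda>c. if c \<in> ?A then g c else h c)"
      by (insert *; cases s; cases b;
        cases "g NW"; cases "g NE"; cases "g SW"; cases "h NE"; simp add: kind_check)
  next
    fix b k
    assume *: "matches b ?r k"
    show "\<exists>g h. matches b s g \<and> matches b Diagonal h \<and>
        (\<forall>(c, d)\<in>?J. (g c \<noteq> h d) = b) \<and> (\<forall>c. k c = (if c \<in> ?A then g c else h c))"
      by (insert *; cases s; cases b;
        cases "k NW"; cases "k NE"; cases "k SW"; simp add: kind_check)
  next
    fix g h a
    assume *: "matches False s g" "matches False Diagonal h" "\<forall>(c, d)\<in>?J. g c = h d"
      "\<forall>c. (if c \<in> ?A then g c else h c) = a"
    show "(\<forall>c. g c = a) \<and> (\<forall>c. h c = a)"
      by (insert *; cases s; cases a;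
        cases "g NW"; cases "g NE"; cases "g SW"; cases "h NE"; simp add: kind_check)
  next
    fix g h g' h'
    assume *: "matches False s g" "matches False Diagonal h" "\<forall>(c, d)\<in>?J. g c = h d"
      "matches True s g'" "matches True Diagonal h'" "\<forall>(c, d)\<in>?J. g' c \<noteq> h' d"
    show "weight_sign s g g' * u + weight_sign Diagonal h h' * v =
        weight_sign ?r (\<lambda>c. if c \<in> ?A then g c else h c) (\<lambda>c. if c \<in> ?A then g' c else h' c) * ?w"
      by (insert *; cases s;
        cases "g NW"; cases "g NE"; cases "g SW"; cases "h NE";
        cases "g' NW"; cases "g' NE"; cases "g' SW"; cases "h' NE"; simp add: kind_check)
  qed
qed

section \<open>The fraction_weight of a fraction\<close>

text \<open>
  The subtractive Euclidean algorithm undoes the twists that lead from \<open>0\<close> or \<open>\<infinity>\<close> to the fraction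
  \<open>p / q\<close>. A horizontal twist negates the count iff the tangle is vertical, which for coprime \<open>p\<close>
  and \<open>q\<close> means that \<open>q\<close> is even, and similarly for vertical twists.
\<close>

fun euclid_weight :: "nat \<Rightarrow> nat \<Rightarrow> rat" where
  "euclid_weight p q =
    (if p = 0 \<or> q = 0 then 0
     else if q \<le> p then if even q then - euclid_weight (p - q) q else euclid_weight (p - q) q + 1
     else if even p then - euclid_weight p (q - p) else euclid_weight p (q - p) + 1)"

declare euclid_weight.simps [simp del]

lemma euclid_weight_0 [simp]: "euclid_weight 0 q = 0" "euclid_weight p 0 = 0"
  by (simp_all add: euclid_weight.simps)

lemma euclid_weight_commute: "euclid_weight p q = euclid_weight q p"
proof (induction p q rule: euclid_weight.induct)
  case (1 p q)
  show ?case
  proof (cases "p = 0 \<or> q = 0 \<or> p = q")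
    case False
    then show ?thesis
      using 1 by (subst (1 2) euclid_weight.simps) auto
  qed auto
qed

lemma euclid_weight_add_left:
  "q > 0 \<Longrightarrow> euclid_weight (p + q) q =
    (if even q then - euclid_weight p q else euclid_weight p q + 1)"
  by (subst euclid_weight.simps) simp

lemma euclid_weight_add_right:
  "p > 0 \<Longrightarrow> euclid_weight p (p + q) =
    (if even p then - euclid_weight p q else euclid_weight p q + 1)"
  using euclid_weight_add_left[of p q] by (simp add: euclid_weight_commute add.commute)

text \<open>
  Reflecting a tangle in the plane of the diagram negates both its fraction and all its signs,
  hence the sign factors.
\<close>

definition fraction_weight :: "int \<Rightarrow> int \<Rightarrow> rat" where
  "fraction_weight p q = of_int (sgn p * sgn q) * euclid_weight (nat \<bar>p\<bar>) (nat \<bar>q\<bar>)"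

lemma fraction_weight_commute: "fraction_weight p q = fraction_weight q p"
  by (simp add: fraction_weight_def euclid_weight_commute mult.commute)

lemma fraction_weight_uminus: "fraction_weight (- p) (- q) = fraction_weight p q"
  by (simp add: fraction_weight_def)

text \<open>
  The recursion holds by definition as long as the twist does not lead from negative to positive
  fractions. For \<open>- q < p < 0\<close> both sides are one step of the Euclidean algorithm away from the
  value at \<open>(\<bar>p\<bar>, p + q)\<close>, and since at most one of these two numbers is even the steps match.
\<close>

lemma fraction_weight_add_left_of_pos:
  assumes cop: "coprime p q" and q: "q > 0"
  shows "fraction_weight (p + q) q = (if even q then - fraction_weight p q else fraction_weight p q + 1)"
proof -
  define c where "c = nat q"
  have c: "q = int c" "c > 0" using q by (auto simp: c_def)
  consider "p \<ge> 0" | "p < 0" "p + q \<ge> 0" | "p + q < 0" using q by linarith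
  then show ?thesis
  proof cases
    case 1
    define a where "a = nat p"
    have p: "p = int a" using 1 by (simp add: a_def)
    show ?thesis
    proof (cases "a = 0")
      case True
      then have "c = 1" using cop c p by simp
      then show ?thesis
        using euclid_weight_add_left[of 1 0] True by (simp add: fraction_weight_def p c)
    next
      case False
      then show ?thesis
        using euclid_weight_add_left[of c a] c(2)
        by (simp add: fraction_weight_def p c nat_add_distrib sgn_if)
    qed
  next
    case 2
    define a where "a = nat (- p)"
    define d where "d = nat (p + q)"
    have p: "p = - int a" and a: "a > 0" and d: "p + q = int d" and cad: "c = a + d"
      using 2 c by (auto simp: a_def d_def)
    have "coprime a d"
    proof -
      have "coprime a c" using cop c p by simp
      then show ?thesis by (simp add: cad coprime_iff_gcd_eq_1)
    qed
    have par: "\<not> (even a \<and> even d)"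
      using \<open>coprime a d\<close> by (metis coprime_common_divisor_nat odd_one coprime_common_divisor)
    show ?thesis
    proof (cases "d = 0")
      case True
      then have "a = 1" using \<open>coprime a d\<close> by simp
      then show ?thesis
        using True euclid_weight_add_left[of 1 0] by (simp add: fraction_weight_def d p c cad)
    next
      case False
      then have "euclid_weight d c = (if even d then - euclid_weight a d else euclid_weight a d + 1)"
        using euclid_weight_add_right[of d a] by (simp add: cad add.commute euclid_weight_commute)
      moreover have "euclid_weight a c = (if even a then - euclid_weight a d else euclid_weight a d + 1)"
        using euclid_weight_add_right[of a d] a by (simp add: cad)
      moreover have "fraction_weight (p + q) q = euclid_weight d c" "fraction_weight p q = - euclid_weight a c"
        using False a c(2) by (simp_all add: fraction_weight_def d) (simp_all add: p c)
      ultimately show ?thesis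
        using par by (auto simp: c(1) cad)
    qed
  next
    case 3
    define a where "a = nat (- (p + q))"
    have p: "p = - int (a + c)" and a: "a > 0" and pq: "p + q = - int a"
      using 3 c by (auto simp: a_def)
    have "fraction_weight (p + q) q = - euclid_weight a c" "fraction_weight p q = - euclid_weight (a + c) c"
      using a c(2) unfolding fraction_weight_def pq by (simp_all add: p c nat_add_distrib add.commute)
    then show ?thesis
      using euclid_weight_add_left[OF c(2), of a] by (auto simp: c add.commute)
  qed
qed

lemma fraction_weight_add_left:
  assumes "coprime p q"
  shows "fraction_weight (p + q) q = (if even q then - fraction_weight p q else fraction_weight p q + 1)"
proof -
  consider "q > 0" | "q < 0" | "q = 0" by linarith
  then show ?thesis
  proof cases
    case 2
    then have "fraction_weight (- p - q) (- q) =
        (if even q then - fraction_weight (- p) (- q) else fraction_weight (- p) (- q) + 1)"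
      using fraction_weight_add_left_of_pos[of "- p" "- q"] assms by simp
    moreover have "fraction_weight (- p - q) (- q) = fraction_weight (p + q) q"
      "fraction_weight (- p) (- q) = fraction_weight p q"
      using fraction_weight_uminus[of "p + q" q] fraction_weight_uminus[of p q]
      by simp_all
    ultimately show ?thesis by simp
  qed (use fraction_weight_add_left_of_pos[OF assms] in \<open>auto simp: fraction_weight_def\<close>)
qed

section \<open>Rational tangles\<close>

lemma ext_inverse_ext_inverse [simp]: "ext_inverse (ext_inverse F) = F"
  by (cases F) auto

lemma ext_add_ext_add: "ext_add (ext_add F a) b = ext_add F (a + b)"
  by (cases F) (simp_all add: add.assoc)

lemma ext_add_0 [simp]: "ext_add F 0 = F"
  by (cases F) auto

lemma ext_inverse_fraction: "coprime p q \<Longrightarrow> ext_inverse (fraction p q) = fraction q p"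
  by (auto simp: fraction_def)

lemma ext_add_fraction: "ext_add (fraction p q) (of_int a) = fraction (p + a * q) q"
  by (auto simp: fraction_def field_simps)

lemma untwist_horizontal:
  assumes "ext_add F (of_int a) = fraction p q"
  shows "F = fraction (p - a * q) q"
  using arg_cong[OF assms, of "\<lambda>F. ext_add F (of_int (- a))"]
  unfolding ext_add_fraction by (simp add: ext_add_ext_add)

lemma untwist_vertical:
  assumes "ext_inverse (ext_add (ext_inverse F) (of_int a)) = fraction p q" "coprime p q"
  shows "F = fraction p (q - a * p)"
proof -
  have "ext_add (ext_inverse F) (of_int a) = fraction q p"
    using arg_cong[OF assms(1), of ext_inverse] assms(2) by (simp add: ext_inverse_fraction)
  then have *: "ext_inverse F = fraction (q - a * p) p"
    by (rule untwist_horizontal)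
  have "gcd (q - a * p) p = gcd q p"
    using gcd_add_mult[of p "- a" q] by (simp add: gcd.commute)
  then have "coprime (q - a * p) p"
    using assms(2) by (simp add: coprime_iff_gcd_eq_1 gcd.commute)
  then show ?thesis
    using arg_cong[OF *, of ext_inverse] by (simp add: ext_inverse_fraction)
qed

definition fraction_kind :: "int \<Rightarrow> int \<Rightarrow> kind" where
  "fraction_kind p q = (if even p then Horizontal else if even q then Vertical else Diagonal)"

lemma coprime_odd: "coprime (p :: int) q \<Longrightarrow> odd p \<or> odd q"
  using coprime_common_divisor by fastforce

text \<open>
  Stating this for every coprime representation of the fraction avoids a normal form: undoing the
  last twist on \<open>p\<close> and \<open>q\<close> gives a coprime representation of the previous fraction.
\<close>

lemma rational_tangle_realizes:
  assumes "rational_tangle T F" "coprime p q" "F = fraction p q"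
  shows "realizes T (fraction_kind p q) (fraction_weight p q)"
  using assms
proof (induction arbitrary: p q rule: rational_tangle.induct)
  case zero
  have "p = 0" using zero.prems by (auto simp: fraction_def split: if_splits)
  then have "\<bar>q\<bar> = 1" using zero.prems(1) by simp
  then have "odd q" by presburger
  then show ?case
    using realizes_elementary_pieces(1) by (simp add: \<open>p = 0\<close> fraction_kind_def fraction_weight_def)
next
  case (horizontal_pos T F)
  have cop: "coprime (p - q) q"
    using horizontal_pos.prems(1) by (simp add: coprime_iff_gcd_eq_1 gcd_diff1)
  have "F = fraction (p - q) q"
    using untwist_horizontal[of F 1 p q] horizontal_pos.prems(2) by simp
  from realizes_beside_Diagonal[OF horizontal_pos.IH[OF cop this] realizes_elementary_pieces(3)]
  show ?case
    using fraction_weight_add_left[OF cop] coprime_odd[OF cop]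
    by (cases "even p"; cases "even q") (simp_all add: fraction_kind_def beside_kind_def)
next
  case (horizontal_neg T F)
  have cop: "coprime (p + q) q"
    using horizontal_neg.prems(1) by (simp add: coprime_iff_gcd_eq_1)
  have "F = fraction (p + q) q"
    using untwist_horizontal[of F "- 1" p q] horizontal_neg.prems(2) by simp
  from realizes_beside_Diagonal[OF horizontal_neg.IH[OF cop this] realizes_elementary_pieces(4)]
  show ?case
    using fraction_weight_add_left[OF horizontal_neg.prems(1)] coprime_odd[OF cop]
    by (cases "even p"; cases "even q") (simp_all add: fraction_kind_def beside_kind_def)
next
  case (vertical_pos T F)
  have cop: "coprime p (q - p)"
    using vertical_pos.prems(1) gcd_diff1[of q p] by (simp add: coprime_iff_gcd_eq_1 gcd.commute)
  have "F = fraction p (q - p)"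
    using untwist_vertical[of F 1 p q] vertical_pos.prems by simp
  from realizes_above[OF vertical_pos.IH[OF cop this] realizes_elementary_pieces(3)]
  show ?case
    using fraction_weight_add_left[of "q - p" p] cop coprime_odd[OF cop]
    by (cases "even p"; cases "even q")
      (simp_all add: fraction_kind_def above_kind_def above_weight_def fraction_weight_commute coprime_commute)
next
  case (vertical_neg T F)
  have cop: "coprime p (p + q)"
    using vertical_neg.prems(1) by (simp add: coprime_iff_gcd_eq_1)
  have "F = fraction p (p + q)"
    using untwist_vertical[of F "- 1" p q] vertical_neg.prems by (simp add: add.commute)
  from realizes_above[OF vertical_neg.IH[OF cop this] realizes_elementary_pieces(4)]
  show ?case
    using fraction_weight_add_left[of q p] vertical_neg.prems(1) coprime_odd[OF cop]
    by (cases "even p"; cases "even q")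
      (simp_all add: fraction_kind_def above_kind_def above_weight_def fraction_weight_commute
        coprime_commute add.commute)
qed

section \<open>Rational links\<close>

lemma labelling_numerator_closure:
  "labelling b (numerator_closure T) f \<longleftrightarrow> labelling b T f \<and>
    (f (ends T NW) \<noteq> f (ends T NE)) = b \<and> (f (ends T SW) \<noteq> f (ends T SE)) = b"
proof -
  have "strands (numerator_closure T) = strands T"
    by (simp add: strands_def numerator_closure_def)
  then show ?thesis
    unfolding labelling_def by (auto simp: numerator_closure_def)
qed

lemma lk_numerator_closure:
  assumes T: "realizes T Horizontal w" and ori: "rational_link_orientation T ori"
  shows "lk (numerator_closure T) ori = w / 2"
proof -
  let ?N = "numerator_closure T"
  have points: "points ?N = points T"
    by (simp add: points_def numerator_closure_def)
  have lab: "labelling False ?N \<chi> \<longleftrightarrow> labelling False T \<chi>" for \<chi>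
    using realizes_matches[OF T, of False \<chi>] by (auto simp: labelling_numerator_closure matches_simps)
  have ends_eq: "\<chi> (ends T NE) = \<chi> (ends T NW)" "\<chi> (ends T SE) = \<chi> (ends T SW)"
    if "labelling False T \<chi>" for \<chi>
    using realizes_matches[OF T that] by (simp_all add: matches_simps)
  have "matches False Horizontal (\<lambda>c. c \<in> {NW, NE})"
    by (simp add: matches_simps)
  from realizes_extend[OF T this] obtain \<chi>\<^sub>0
    where \<chi>\<^sub>0: "labelling False T \<chi>\<^sub>0" "\<forall>c. \<chi>\<^sub>0 (ends T c) = (c \<in> {NW, NE})" by blast
  have "\<exists>\<chi>. labelling False ?N \<chi> \<and> \<chi> (ends T NW) \<and> \<not> \<chi> (ends T SW) \<and>
      (\<forall>ori. lk ?N ori = signed_crossings ?N \<chi> ori / 2)"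
  proof (rule two_components(2))
    show "ends T NW \<in> points ?N" "ends T SW \<in> points ?N"
      by (simp_all add: points realizes_ends[OF T])
    show "labelling False ?N \<chi>\<^sub>0" "\<chi>\<^sub>0 (ends T NW) \<noteq> \<chi>\<^sub>0 (ends T SW)"
      using \<chi>\<^sub>0 by (simp_all add: lab)
    show "\<forall>x\<in>points ?N. \<chi> x"
      if "labelling False ?N \<chi>" "\<chi> (ends T NW)" "\<chi> (ends T SW)" for \<chi>
    proof -
      have "\<forall>c. \<chi> (ends T c) = True"
        using that ends_eq[of \<chi>] by (simp add: lab all_corner)
      then show ?thesis
        using realizes_mono[OF T, of \<chi> True] that(1) by (simp add: lab points)
    qed
  qed
  then obtain \<chi> where \<chi>: "labelling False T \<chi>" "\<chi> (ends T NW)" "\<not> \<chi> (ends T SW)"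
    and lk: "lk ?N ori = signed_crossings ?N \<chi> ori / 2"
    by (auto simp: lab)
  have "labelling True T ori" and "ori (ends T NW) \<noteq> ori (ends T SW)"
    using ori by (auto simp: rational_link_orientation_def orientation_iff_labelling
        labelling_numerator_closure)
  moreover have "signed_crossings ?N \<chi> ori = signed_crossings T \<chi> ori"
    by (rule signed_crossings_cong) (simp add: numerator_closure_def)
  ultimately have "signed_crossings ?N \<chi> ori = w"
    using realizes_weight[OF T \<chi>(1), of ori] \<chi> by (simp add: weight_sign_def all_corner)
  then show ?thesis using lk by simp
qed

lemma ex_rational_link_orientation:
  assumes T: "realizes T Horizontal w"
  shows "\<exists>ori. rational_link_orientation T ori"
proof -
  have "matches True Horizontal (\<lambda>c. c \<in> {NW, SE})"
    by (simp add: matches_simps)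
  from realizes_extend[OF T this] obtain ori
    where "labelling True T ori" "\<forall>c. ori (ends T c) = (c \<in> {NW, SE})" by blast
  then have "rational_link_orientation T ori"
    by (simp add: rational_link_orientation_def orientation_iff_labelling labelling_numerator_closure)
  then show ?thesis by (rule exI[of _ ori])
qed

text \<open>
  The description of \<open>lk_R\<close> is well defined: the value depends on \<open>p\<close> and \<open>q\<close> only, and a tangle
  of the given fraction, which provides the existence part, is assumed.
\<close>

lemma lk_R_eq:
  assumes T: "rational_tangle T (fraction p q)" and cop: "coprime p q" and p: "even p"
  shows "lk_R p q = fraction_weight p q / 2"
proof -
  have real: "realizes T' Horizontal (fraction_weight p q)" if "rational_tangle T' (fraction p q)" for T'
    using rational_tangle_realizes[OF that cop refl] p by (simp add: fraction_kind_def)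
  obtain ori where ori: "rational_link_orientation T ori"
    using ex_rational_link_orientation[OF real[OF T]] by blast
  show ?thesis
    unfolding lk_R_def
  proof (rule the_equality)
    show "\<exists>T ori. rational_tangle T (fraction p q) \<and> rational_link_orientation T ori \<and>
        fraction_weight p q / 2 = lk (numerator_closure T) ori"
      using T ori lk_numerator_closure[OF real[OF T] ori] by (intro exI conjI) auto
    show "l = fraction_weight p q / 2"
      if "\<exists>T ori. rational_tangle T (fraction p q) \<and> rational_link_orientation T ori \<and>
        l = lk (numerator_closure T) ori" for l
      using that lk_numerator_closure[OF real] by auto
  qed
qed

lemma H_tangle_iff:
  assumes T: "realizes T s w"
  shows "H_tangle T \<longleftrightarrow> s = Horizontal"
proof
  assume "H_tangle T"
  then have same: "\<chi> (ends T NW) = \<chi> (ends T NE)" if "labelling False T \<chi>" for \<chi>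
    using connected_points_imp_same_label that unfolding H_tangle_def by blast
  show "s = Horizontal"
  proof (rule ccontr)
    assume "s \<noteq> Horizontal"
    then have "matches False s (\<lambda>c. c \<in> {NW, mate s NW})"
      by (cases s) (simp_all add: matches_simps)
    from realizes_extend[OF T this] show False
      using same \<open>s \<noteq> Horizontal\<close> by (cases s) auto
  qed
next
  assume s: "s = Horizontal"
  have "labelling False T (\<lambda>x. \<exists>u\<in>{ends T NW}. (u, x) \<in> connected_points T)"
    by (rule labelling_reachable)
  from realizes_matches[OF T this] show "H_tangle T"
    unfolding s by (auto simp: matches_simps H_tangle_def connected_points_def)
qed

section \<open>Stacks of tangles\<close>

lemma shift_shift [simp]: "shift m (shift n x) = shift (m + n) x"
  by (cases x) (simp add: shift_def)

lemma above_assoc: "above (above S T) U = above S (above T U)"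
proof -
  have comp: "map_prod (shift m) (shift m) ` map_prod (shift n) (shift n) ` X =
      map_prod (shift (m + n)) (shift (m + n)) ` X" for m n X
    by (simp add: image_image map_prod_def split_def)
  show ?thesis
    by (auto simp: above_def Let_def image_Un comp)
qed

lemma foldr_above_snoc: "foldr above (Ss @ [T]) U = above (foldr above Ss T) U"
  by (induction Ss) (simp_all add: above_assoc)

lemma vertical_stack_eq_foldr: "vertical_stack Ts = foldr above Ts (elementary VArcs)"
  by (induction Ts) auto

text \<open>
  Both strands run from top to bottom, and they change sides iff \<open>m\<close> is odd. For tangles of
  fraction \<open>p / q\<close> other than \<open>H\<close>-tangles, \<open>m = q\<close> will do. Only the parity of \<open>m\<close> matters, but
  integers make it additive.
\<close>

definition passes :: "tangle \<Rightarrow> int \<Rightarrow> bool" where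
  "passes T m \<longleftrightarrow> (\<exists>s w. realizes T s w \<and> s \<noteq> Horizontal \<and> (s = Diagonal \<longleftrightarrow> odd m))"

lemma passes_above:
  assumes "passes S m" "passes T n"
  shows "passes (above S T) (m + n)"
proof -
  obtain s u where s: "realizes S s u" "s \<noteq> Horizontal" "s = Diagonal \<longleftrightarrow> odd m"
    using assms(1) by (auto simp: passes_def)
  obtain t v where t: "realizes T t v" "t \<noteq> Horizontal" "t = Diagonal \<longleftrightarrow> odd n"
    using assms(2) by (auto simp: passes_def)
  have "above_kind s t \<noteq> Horizontal \<and> (above_kind s t = Diagonal \<longleftrightarrow> odd (m + n))"
    using s(2,3) t(2,3) by (cases s; cases t) (auto simp: above_kind_def)
  then show ?thesis
    using realizes_above[OF s(1) t(1)] s(2) unfolding passes_def by blast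
qed

lemma passes_above_Horizontal:
  assumes "passes S m" "realizes T Horizontal w"
  shows "realizes (above S T) Horizontal ((- 1) powi m * w)"
proof -
  obtain s u where s: "realizes S s u" "s \<noteq> Horizontal" "s = Diagonal \<longleftrightarrow> odd m"
    using assms(1) by (auto simp: passes_def)
  show ?thesis
    using realizes_above[OF s(1) assms(2)] s(2,3)
    by (cases "even m") (simp_all add: above_kind_def above_weight_def)
qed

lemma Horizontal_above_passes:
  assumes "realizes S Horizontal w" "passes T m"
  shows "realizes (above S T) Horizontal ((- 1) powi m * w)"
proof -
  obtain t v where t: "realizes T t v" "t \<noteq> Horizontal" "t = Diagonal \<longleftrightarrow> odd m"
    using assms(2) by (auto simp: passes_def)
  show ?thesis
    using realizes_above[OF assms(1) t(1)] t(2,3)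
    by (cases "even m") (simp_all add: above_kind_def above_weight_def)
qed

lemma passes_foldr_above:
  assumes "\<And>k. k \<in> set ks \<Longrightarrow> passes (T k) (m k)" "passes U n"
  shows "passes (foldr above (map T ks) U) (sum_list (map m ks) + n)"
  using assms by (induction ks) (auto simp: add.assoc intro!: passes_above)

text \<open>
  A stack with a single \<open>H\<close>-tangle again behaves like an \<open>H\<close>-tangle, with the same count up to
  the sign given by the number of times the strands change sides.
\<close>

lemma foldr_above_Horizontal:
  assumes "\<And>k. k \<in> set ks \<Longrightarrow> passes (T k) (m k)" "realizes U Horizontal w"
  shows "realizes (foldr above (map T ks) U) Horizontal ((- 1) powi sum_list (map m ks) * w)"
  using assms
proof (induction ks)
  case (Cons k ks)
  have "realizes (above (T k) (foldr above (map T ks) U)) Horizontal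
      ((- 1) powi m k * ((- 1) powi sum_list (map m ks) * w))"
    using Cons by (intro passes_above_Horizontal) auto
  then show ?case by (simp add: power_int_add mult.assoc)
qed simp

lemma passes_half_twists: "passes (foldr above (half_twists e) (elementary VArcs)) e"
proof -
  define x where "x = elementary (if e > 0 then PosSlope else NegSlope)"
  have "passes x 1"
    using realizes_elementary_pieces(3,4) by (auto simp: passes_def x_def)
  moreover have "passes (elementary VArcs) 0"
    using realizes_elementary_pieces(2) by (auto simp: passes_def)
  ultimately have "passes (foldr above (map (\<lambda>_. x) [0..<nat \<bar>e\<bar>]) (elementary VArcs))
      (sum_list (map (\<lambda>_. 1) [0..<nat \<bar>e\<bar>]) + 0)"
    by (intro passes_foldr_above)
  moreover have "map (\<lambda>_. x) [0..<nat \<bar>e\<bar>] = half_twists e"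
    by (simp add: half_twists_def x_def map_replicate_const)
  ultimately show ?thesis
    by (simp add: passes_def sum_list_triv)
qed

section \<open>Montesinos links\<close>

lemma labelling_denominator_closure:
  "labelling b (denominator_closure T) f \<longleftrightarrow> labelling b T f \<and>
    (f (ends T SW) \<noteq> f (ends T NW)) = b \<and> (f (ends T SE) \<noteq> f (ends T NE)) = b"
proof -
  have "strands (denominator_closure T) = strands T"
    by (simp add: strands_def denominator_closure_def)
  then show ?thesis
    unfolding labelling_def by (auto simp: denominator_closure_def)
qed

text \<open>
  The closed stack of two horizontal tangles has the components "top of \<open>S\<close> and bottom of \<open>T\<close>"
  and "bottom of \<open>S\<close> and top of \<open>T\<close>". Every orientation runs along them in such a way that the
  strands of \<open>S\<close> have their reference orientation iff those of \<open>T\<close> do, so the counts add up.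
\<close>

lemma denominator_closure_Horizontal_above_Horizontal:
  assumes S: "realizes S Horizontal u" and T: "realizes T Horizontal v"
  defines "D \<equiv> denominator_closure (above S T)"
  shows "card (components D) = 2"
    and "orientation D ori \<Longrightarrow> \<exists>s\<in>{1, - 1}. lk D ori = s * (u + v) / 2"
proof -
  let ?r = "shift (length (pieces S))"
  have "points D = points (above S T)"
    by (simp add: D_def points_def denominator_closure_def)
  then have points: "points D = points S \<union> ?r ` points T"
    by (simp only: above_eq_glue points_glue)
  have ends: "ends (above S T) NW = ends S NW" "ends (above S T) NE = ends S NE"
    "ends (above S T) SW = ?r (ends T SW)" "ends (above S T) SE = ?r (ends T SE)"
    by (simp_all add: above_def Let_def)
  have lab: "labelling b D f \<longleftrightarrow> labelling b S f \<and> labelling b T (\<lambda>x. f (?r x)) \<and>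
      (f (ends S SW) \<noteq> f (?r (ends T NW))) = b \<and> (f (ends S SE) \<noteq> f (?r (ends T NE))) = b \<and>
      (f (?r (ends T SW)) \<noteq> f (ends S NW)) = b \<and> (f (?r (ends T SE)) \<noteq> f (ends S NE)) = b" for b f
    unfolding D_def labelling_denominator_closure ends
    unfolding above_eq_glue labelling_glue by (simp only: ball_simps prod.case conj_assoc simp_thms)
  have ends_eq: "f (ends S NE) = (f (ends S NW) \<noteq> b)" "f (ends S SE) = (f (ends S SW) \<noteq> b)"
    "f (?r (ends T NW)) = (f (ends S SW) \<noteq> b)" "f (?r (ends T NE)) = f (ends S SW)"
    "f (?r (ends T SW)) = (f (ends S NW) \<noteq> b)" "f (?r (ends T SE)) = f (ends S NW)"
    if f: "labelling b D f" for b f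
  proof -
    note f' = f[unfolded lab]
    have fS: "f (ends S NE) = (f (ends S NW) \<noteq> b)" "f (ends S SE) = (f (ends S SW) \<noteq> b)"
      using realizes_matches[OF S conjunct1[OF f']] unfolding matches_simps by blast+
    have joined: "f (?r (ends T NW)) = (f (ends S SW) \<noteq> b)"
      "f (?r (ends T NE)) = (f (ends S SE) \<noteq> b)"
      "f (?r (ends T SW)) = (f (ends S NW) \<noteq> b)" "f (?r (ends T SE)) = (f (ends S NE) \<noteq> b)"
      using f' by blast+
    show "f (ends S NE) = (f (ends S NW) \<noteq> b)" "f (ends S SE) = (f (ends S SW) \<noteq> b)"
      "f (?r (ends T NW)) = (f (ends S SW) \<noteq> b)" "f (?r (ends T NE)) = f (ends S SW)"
      "f (?r (ends T SW)) = (f (ends S NW) \<noteq> b)" "f (?r (ends T SE)) = f (ends S NW)"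
      unfolding joined fS by blast+
  qed
  have ends_eq_True: "f (ends S NE) = (\<not> f (ends S NW))" "f (ends S SE) = (\<not> f (ends S SW))"
    "f (?r (ends T NW)) = (\<not> f (ends S SW))" "f (?r (ends T SW)) = (\<not> f (ends S NW))"
    if "labelling True D f" for f
    using ends_eq[OF that] by simp_all
  define g where "g = (\<lambda>c. c \<in> {NW, NE})"
  have "matches False Horizontal g" "matches False Horizontal (\<lambda>c. \<not> g c)"
    by (simp_all add: matches_simps g_def)
  from realizes_extend[OF S this(1)] realizes_extend[OF T this(2)] obtain \<chi>S \<chi>T
    where \<chi>S: "labelling False S \<chi>S" "\<forall>c. \<chi>S (ends S c) = g c"
      and \<chi>T: "labelling False T \<chi>T" "\<forall>c. \<chi>T (ends T c) = (\<not> g c)"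
    by (elim exE conjE)
  \<comment> \<open>a colouring that tells the two components apart\<close>
  define \<chi>\<^sub>0 where "\<chi>\<^sub>0 = (\<lambda>(k, c). if k < length (pieces S) then \<chi>S (k, c)
    else \<chi>T (k - length (pieces S), c))"
  have \<chi>\<^sub>0S: "\<chi>\<^sub>0 x = \<chi>S x" if "x \<in> points S" for x
    using that by (auto simp: \<chi>\<^sub>0_def points_def)
  have \<chi>\<^sub>0T: "\<chi>\<^sub>0 (?r x) = \<chi>T x" for x
    by (auto simp: \<chi>\<^sub>0_def shift_def split: prod.splits)
  have \<chi>\<^sub>0: "labelling False D \<chi>\<^sub>0"
    unfolding lab using \<chi>S \<chi>T labelling_cong[OF realizes_joins[OF S] \<chi>\<^sub>0S]
    by (simp add: \<chi>\<^sub>0T \<chi>\<^sub>0S[OF realizes_ends[OF S]] g_def)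
  have in_points: "ends S NW \<in> points D" "ends S SW \<in> points D"
    using realizes_ends[OF S] by (auto simp: points)
  have separated: "\<chi>\<^sub>0 (ends S NW) \<noteq> \<chi>\<^sub>0 (ends S SW)"
    using \<chi>S(2) by (simp add: \<chi>\<^sub>0S[OF realizes_ends[OF S]] g_def)
  have exhausted: "\<forall>x\<in>points D. \<chi> x"
    if \<chi>: "labelling False D \<chi>" "\<chi> (ends S NW)" "\<chi> (ends S SW)" for \<chi>
  proof -
    have "\<forall>c. \<chi> (ends S c) = True" "\<forall>c. \<chi> (?r (ends T c)) = True"
      using ends_eq[OF \<chi>(1)] \<chi>(2,3) by (simp_all add: all_corner)
    then show ?thesis
      using realizes_mono[OF S, of \<chi> True] realizes_mono[OF T, of "\<lambda>x. \<chi> (?r x)" True] \<chi>(1)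
      by (auto simp: lab points)
  qed
  show "card (components D) = 2"
    by (rule two_components(1)[OF in_points \<chi>\<^sub>0 separated exhausted])
  obtain \<chi> where \<chi>: "labelling False D \<chi>" "\<chi> (ends S NW)" "\<not> \<chi> (ends S SW)"
    and lk: "\<And>ori. lk D ori = signed_crossings D \<chi> ori / 2"
    using two_components(2)[OF in_points \<chi>\<^sub>0 separated exhausted] by blast
  show "\<exists>s\<in>{1, - 1}. lk D ori = s * (u + v) / 2" if "orientation D ori"
  proof -
    have ori: "labelling True D ori"
      using that by (simp add: orientation_iff_labelling)
    have "signed_crossings D \<chi> ori =
        signed_crossings S \<chi> ori + signed_crossings T (\<lambda>x. \<chi> (?r x)) (\<lambda>x. ori (?r x))"
      unfolding signed_crossings_glue[symmetric, of S \<chi> ori T "{(SW, NW), (SE, NE)}" "{NW, NE}"]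
      by (rule signed_crossings_cong) (simp add: D_def above_eq_glue denominator_closure_def)
    also have "signed_crossings S \<chi> ori =
        (if ori (ends S NW) \<noteq> ori (ends S SW) then 1 else - 1) * u"
      using realizes_weight[OF S, of \<chi> ori] \<chi> ori
      by (simp add: lab weight_sign_def all_corner)
    also have "signed_crossings T (\<lambda>x. \<chi> (?r x)) (\<lambda>x. ori (?r x)) =
        (if ori (ends S NW) \<noteq> ori (ends S SW) then 1 else - 1) * v"
    proof -
      have "\<not> \<chi> (?r (ends T NW))" "\<chi> (?r (ends T SW))"
        using ends_eq[OF \<chi>(1)] \<chi>(2,3) by simp_all
      moreover have "labelling False T (\<lambda>x. \<chi> (?r x))" "labelling True T (\<lambda>x. ori (?r x))"
        using \<chi>(1) ori by (simp_all add: lab)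
      ultimately show ?thesis
        using realizes_weight[OF T, of "\<lambda>x. \<chi> (?r x)" "\<lambda>x. ori (?r x)"] ends_eq_True[OF ori]
        by (simp add: weight_sign_def all_corner)
    qed
    finally have "lk D ori = (if ori (ends S NW) \<noteq> ori (ends S SW) then 1 else - 1) * (u + v) / 2"
      by (simp add: lk field_simps)
    then show ?thesis by (auto split: if_splits)
  qed
qed

text \<open>
  Cutting the stack just below \<open>T\<^sub>i\<close> gives two stacks with one \<open>H\<close>-tangle each, closed up as in
  the previous lemma. Their signs multiply to \<open>(- 1)\<close> to the sum of \<open>e\<close> and the \<open>q\<^sub>k\<close> with
  \<open>k \<noteq> i, j\<close>, and adding the two odd numbers \<open>q\<^sub>i\<close> and \<open>q\<^sub>j\<close> does not change its parity.
\<close>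

lemma lk_montesinos:
  fixes p q :: "nat \<Rightarrow> int" and T :: "nat \<Rightarrow> tangle"
  assumes cop: "\<And>k. k \<in> {1..n} \<Longrightarrow> coprime (p k) (q k)"
    and rat: "\<And>k. k \<in> {1..n} \<Longrightarrow> rational_tangle (T k) (fraction (p k) (q k))"
    and L: "L = montesinos (map T [1..<Suc n]) e"
    and ij: "i \<in> {1..n}" "j \<in> {1..n}" "i < j"
    and H: "{k \<in> {1..n}. H_tangle (T k)} = {i, j}"
  shows "card (components L) = 2"
    and "orientation L ori \<Longrightarrow> \<exists>s\<in>{1, - 1}. lk L ori =
      s * (lk_R (p i) (q i) + (- 1) powi ((\<Sum>k = 1..n. q k) + e) * lk_R (p j) (q j))"
proof -
  define A where "A = [1..<i]"
  define B where "B = [Suc i..<j]"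
  define C where "C = [Suc j..<Suc n]"
  let ?w = "\<lambda>k. fraction_weight (p k) (q k)"
  have "[1..<Suc n] = A @ [1 + (i - 1)..<Suc n]"
    using upt_add_eq_append[of 1 i "Suc n - i"] ij by (simp add: A_def)
  also have "[1 + (i - 1)..<Suc n] = i # [Suc i..<Suc n]"
    using ij by (simp add: upt_conv_Cons)
  also have "[Suc i..<Suc n] = B @ [j..<Suc n]"
    using upt_add_eq_append[of "Suc i" j "Suc n - j"] ij by (simp add: B_def)
  also have "[j..<Suc n] = j # C"
    using ij by (simp add: upt_conv_Cons C_def)
  finally have upt: "[1..<Suc n] = A @ i # B @ j # C" .
  have real: "realizes (T k) (fraction_kind (p k) (q k)) (?w k)" if "k \<in> {1..n}" for k
    using rational_tangle_realizes[OF rat[OF that] cop[OF that] refl] .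
  have kind: "fraction_kind (p k) (q k) = Horizontal \<longleftrightarrow> k \<in> {i, j}" if "k \<in> {1..n}" for k
    using H_tangle_iff[OF real[OF that]] H that by blast
  have passes: "passes (T k) (q k)" if "k \<in> set A \<union> set B \<union> set C" for k
  proof -
    have "k \<in> {1..n}" "k \<notin> {i, j}"
      using that ij by (auto simp: A_def B_def C_def)
    then have "fraction_kind (p k) (q k) \<noteq> Horizontal" "k \<in> {1..n}" using kind by auto
    then show ?thesis
      using real[of k] by (auto simp: passes_def fraction_kind_def split: if_splits)
  qed
  have even: "even (p k)" "odd (q k)" and hor: "realizes (T k) Horizontal (?w k)"
    if "k \<in> {i, j}" for k
  proof -
    have k: "k \<in> {1..n}" using that ij by auto
    then show "even (p k)"
      using kind[OF k] that by (auto simp: fraction_kind_def split: if_splits)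
    then show "odd (q k)" using coprime_odd[OF cop[OF k]] by blast
    show "realizes (T k) Horizontal (?w k)"
      using real[OF k] kind[OF k] that by simp
  qed
  define S where "S = foldr above (map T A) (T i)"
  define U where "U = foldr above (map T C) (foldr above (half_twists e) (elementary VArcs))"
  define V where "V = foldr above (map T B) (above (T j) U)"
  define a where "a = sum_list (map q A)"
  define b where "b = sum_list (map q B) + (sum_list (map q C) + e)"
  have S: "realizes S Horizontal ((- 1) powi a * ?w i)"
    unfolding S_def a_def by (rule foldr_above_Horizontal) (use passes hor in auto)
  have "passes U (sum_list (map q C) + e)"
    unfolding U_def using passes passes_half_twists by (intro passes_foldr_above) auto
  then have "realizes (above (T j) U) Horizontal ((- 1) powi (sum_list (map q C) + e) * ?w j)"
    using hor[of j] by (intro Horizontal_above_passes) auto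
  then have "realizes V Horizontal
      ((- 1) powi sum_list (map q B) * ((- 1) powi (sum_list (map q C) + e) * ?w j))"
    unfolding V_def using passes by (intro foldr_above_Horizontal) auto
  then have V: "realizes V Horizontal ((- 1) powi b * ?w j)"
    by (simp add: b_def power_int_add mult.assoc)
  have "map T [1..<Suc n] @ half_twists e =
      (map T A @ [T i]) @ map T B @ T j # map T C @ half_twists e"
    unfolding upt by simp
  then have "L = denominator_closure (above (foldr above (map T A) (T i))
      (foldr above (map T B @ T j # map T C @ half_twists e) (elementary VArcs)))"
    unfolding L montesinos_def vertical_stack_eq_foldr
    by (simp only: foldr_append[of _ "map T A @ [T i]"] foldr_above_snoc)
  then have L_eq: "L = denominator_closure (above S V)"
    by (simp add: S_def V_def U_def)
  show "card (components L) = 2"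
    unfolding L_eq by (rule denominator_closure_Horizontal_above_Horizontal(1)[OF S V])
  assume "orientation L ori"
  then obtain s where s: "s \<in> {1, - 1}"
    and lk: "lk L ori = s * ((- 1) powi a * ?w i + (- 1) powi b * ?w j) / 2"
    using denominator_closure_Horizontal_above_Horizontal(2)[OF S V] unfolding L_eq by blast
  have "(\<Sum>k = 1..n. q k) = sum_list (map q [1..<Suc n])"
    by (simp add: interv_sum_list_conv_sum_set_nat atLeastLessThanSuc_atLeastAtMost del: upt_Suc)
  also have "\<dots> + e = a + b + (q i + q j)"
    unfolding upt by (simp add: a_def b_def)
  finally have "even ((\<Sum>k = 1..n. q k) + e) \<longleftrightarrow> even (a + b)"
    using even(2)[of i] even(2)[of j] by simp
  then have sign: "(- 1 :: rat) powi ((\<Sum>k = 1..n. q k) + e) = (- 1) powi a * (- 1) powi b"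
    by (cases "even a"; cases "even b") simp_all
  have w: "?w k = 2 * lk_R (p k) (q k)" if "k \<in> {i, j}" for k
    using lk_R_eq[OF rat cop even(1)[OF that]] that ij by auto
  have "s * (- 1) powi a \<in> {1, - 1}"
    using s by (cases "even a") auto
  moreover have "lk L ori = s * (- 1) powi a * (lk_R (p i) (q i) +
      (- 1) powi ((\<Sum>k = 1..n. q k) + e) * lk_R (p j) (q j))"
    unfolding lk sign by (cases "even a") (simp_all add: w field_simps)
  ultimately show "\<exists>s\<in>{1, - 1}. lk L ori =
      s * (lk_R (p i) (q i) + (- 1) powi ((\<Sum>k = 1..n. q k) + e) * lk_R (p j) (q j))"
    by (rule bexI[rotated])
qed

theorem theorem4:
  fixes n i j :: nat and p q :: "nat \<Rightarrow> int" and e :: int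
    and T :: "nat \<Rightarrow> tangle" and L :: diagram
  assumes "\<And>k. k \<in> {1..n} \<Longrightarrow> coprime (p k) (q k)"
    and "\<And>k. k \<in> {1..n} \<Longrightarrow> rational_tangle (T k) (fraction (p k) (q k))"
    and "L = montesinos (map T [1..<Suc n]) e"
    and "i \<in> {1..n}" and "j \<in> {1..n}" and "i \<noteq> j"
    and "{k \<in> {1..n}. H_tangle (T k)} = {i, j}"
  shows "card (components L) = 2 \<and>
    (\<forall>ori. orientation L ori \<longrightarrow>
      (\<exists>s \<in> {1, - 1}. lk L ori =
        s * (lk_R (p i) (q i) + (- 1) powi ((\<Sum>k = 1..n. q k) + e) * lk_R (p j) (q j))))"
proof (cases "i < j")
  case True
  show ?thesis
    using lk_montesinos[of n p q T L e i j, OF assms(1-5) True assms(7)] by blast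
next
  case False
  then have "j < i" using assms(6) by simp
  have "{k \<in> {1..n}. H_tangle (T k)} = {j, i}"
    using assms(7) by (simp add: insert_commute)
  \<comment> \<open>exchanging the two terms multiplies the sum by the sign, which the overall sign absorbs\<close>
  note swapped = lk_montesinos[of n p q T L e j i, OF assms(1-3) assms(5,4) \<open>j < i\<close> this]
  let ?\<epsilon> = "(- 1 :: rat) powi ((\<Sum>k = 1..n. q k) + e)"
  have eps: "?\<epsilon> = 1 \<or> ?\<epsilon> = - 1"
    by (cases "even ((\<Sum>k = 1..n. q k) + e)") simp_all
  have "\<exists>s'\<in>{1, - 1}. s * (lk_R (p j) (q j) + ?\<epsilon> * lk_R (p i) (q i)) =
      s' * (lk_R (p i) (q i) + ?\<epsilon> * lk_R (p j) (q j))" if "s \<in> {1, - 1}" for s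
    using that eps by (intro bexI[of _ "s * ?\<epsilon>"]) (auto simp: algebra_simps)
  then show ?thesis using swapped by metis
qed

end
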